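(* For each $k\in\mathbb{N}$ let $0=t^{(k)}_0<t^{(k)}_1<\dots<t^{(k)}_{N_k}<t^{(k)}_{N_k+1}=1$ be a partition of $[0,1]$, and suppose that $$\delta_k:=\sup_{0\le i\le N_k}\bigl(t^{(k)}_{i+1}-t^{(k)}_i\bigr)\to0\quad\text{as }k\to\infty.$$ Then, as $k\to\infty$, one has the (measureless) Gromov--Hausdorff convergence $$\bigl(X(\{t^{(k)}_i\}_{i=1}^{N_k}),\,d^{\{t^{(k)}_i\}}\bigr)\xrightarrow{GH}(\mathcal{G}_0,d^{L^2}).$$
   Context: $\mathcal{G}_0\subset L^2([0,1])$ is the set of right continuous, nondecreasing functions $g:[0,1]\to[0,1]$ with $g(1)=1$ (regarded as elements of $L^2([0,1])$), and $d^{L^2}(f,g)=\|f-g\|_{L^2([0,1])}$. For a partition $\{t_i\}_{i=1}^N$, i.e. $0=t_0<t_1<\dots<t_N<t_{N+1}=1$, the metric space $(X(\{t_i\}),d^{\{t_i\}})$ is the set $$X(\{t_i\}_{i=1}^N)=\Sigma_N:=\{(x_1,\dots,x_N)\in[0,1]^N:0=x_0<x_1<\dots<x_N<x_{N+1}=1\}$$ with the metric $$d^{\{t_i\}}(x,y)^2:=\sum_{i=1}^N|x_i-y_i|^2\,|t_{i+1}-t_i|.$$ For metric spaces $X,Y$ and $\epsilon>0$, a (not necessarily continuous) map $f:X\to Y$ is an $\epsilon$-isometry if (1) $|d_X(x,x')-d_Y(f(x),f(x'))|\le\epsilon$ for all $x,x'\in X$, and (2) for every $y\in Y$ there is $x\in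 X$ with $d_Y(y,f(x))\le\epsilon$. A sequence $(X_n,d_n)$ converges to $(X,d)$ in the (measureless) Gromov--Hausdorff topology, written $(X_n,d_n)\xrightarrow{GH}(X,d)$, if there are $\epsilon_n\to0$ and $\epsilon_n$-isometries $f_n:X_n\to X$. *)

theory Defs
  imports "HOL-Analysis.Analysis"
begin

definition eps_isometry :: "real \<Rightarrow> 'a metric \<Rightarrow> 'b metric \<Rightarrow> ('a \<Rightarrow> 'b) \<Rightarrow> bool" where
  "eps_isometry \<epsilon> X Y f \<longleftrightarrow>
     0 < \<epsilon> \<and> f \<in> mspace X \<rightarrow> mspace Y \<and>
     (\<forall>x\<in>mspace X. \<forall>x'\<in>mspace X. \<bar>mdist X x x' - mdist Y (f x) (f x')\<bar> \<le> \<epsilon>) \<and>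
     (\<forall>y\<in>mspace Y. \<exists>x\<in>mspace X. mdist Y y (f x) \<le> \<epsilon>)"

definition GH_converges :: "(nat \<Rightarrow> 'a metric) \<Rightarrow> 'b metric \<Rightarrow> bool" where
  "GH_converges Xs X \<longleftrightarrow>
     (\<exists>\<epsilon> f. \<epsilon> \<longlonglongrightarrow> 0 \<and> (\<forall>n. eps_isometry (\<epsilon> n) (Xs n) X (f n)))"

definition unit_partition :: "nat \<Rightarrow> (nat \<Rightarrow> real) \<Rightarrow> bool" where
  "unit_partition N t \<longleftrightarrow> t 0 = 0 \<and> t (Suc N) = 1 \<and> (\<forall>i\<le>N. t i < t (Suc i))"

text \<open>A point \<open>(x\<^sub>1, \<dots>, x\<^sub>N)\<close> is encoded as an extensional function on \<open>{0..N+1}\<close> that also carries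
  the conventional values \<open>x\<^sub>0 = 0\<close> and \<open>x\<^sub>N\<^sub>+\<^sub>1 = 1\<close>.\<close>

definition ordered_simplex :: "nat \<Rightarrow> (nat \<Rightarrow> real) set" where
  "ordered_simplex N = {x \<in> {0..Suc N} \<rightarrow>\<^sub>E {0..1}. unit_partition N x}"

definition partition_dist :: "nat \<Rightarrow> (nat \<Rightarrow> real) \<Rightarrow> (nat \<Rightarrow> real) \<Rightarrow> (nat \<Rightarrow> real) \<Rightarrow> real" where
  "partition_dist N t x y = sqrt (\<Sum>i=1..N. \<bar>x i - y i\<bar>\<^sup>2 * \<bar>t (Suc i) - t i\<bar>)"

text \<open>Meaningful only if \<open>unit_partition N t\<close>, which makes the argument of \<^const>\<open>metric\<close> a metric space
  (\<open>Metric_space_partition\<close> below).\<close>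

definition partition_space :: "nat \<Rightarrow> (nat \<Rightarrow> real) \<Rightarrow> (nat \<Rightarrow> real) metric" where
  "partition_space N t = metric (ordered_simplex N, partition_dist N t)"

text \<open>Each class in \<open>L\<^sup>2([0,1])\<close> that has a right continuous representative \<open>g\<close> with \<open>g 1 = 1\<close> has only
  one, so this representative, made extensional on \<open>[0,1]\<close>, stands for the class.  That no two
  representatives are identified in \<open>L\<^sup>2\<close> is part of \<open>Metric_space_G0\<close> below.\<close>

definition G0_set :: "(real \<Rightarrow> real) set" where
  "G0_set = {g \<in> {0..1} \<rightarrow>\<^sub>E {0..1}.
     mono_on {0..1} g \<and> (\<forall>x\<in>{0..<1}. continuous (at_right x) g) \<and> g 1 = 1}"

definition L2_dist :: "(real \<Rightarrow> real) \<Rightarrow> (real \<Rightarrow> real) \<Rightarrow> real" where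
  "L2_dist f g = sqrt (LINT x:{0..1}|lborel. \<bar>f x - g x\<bar>\<^sup>2)"

definition G0_space :: "(real \<Rightarrow> real) metric" where
  "G0_space = metric (G0_set, L2_dist)"

lemma Metric_space_partition:
  assumes "unit_partition N t"
  shows "Metric_space (ordered_simplex N) (partition_dist N t)"
proof
  have pos: "t (Suc i) - t i > 0" if "i \<in> {1..N}" for i
    using assms that by (simp add: unit_partition_def)
  fix x y z
  show "0 \<le> partition_dist N t x y"
    by (simp add: partition_dist_def sum_nonneg)
  show "partition_dist N t x y = partition_dist N t y x"
    by (simp add: partition_dist_def power2_commute)
  assume x: "x \<in> ordered_simplex N" and y: "y \<in> ordered_simplex N"
  show "partition_dist N t x y = 0 \<longleftrightarrow> x = y"
  proof
    assume "partition_dist N t x y = 0"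
    then have 0: "\<forall>i\<in>{1..N}. \<bar>x i - y i\<bar>\<^sup>2 * \<bar>t (Suc i) - t i\<bar> = 0"
      unfolding partition_dist_def by (simp add: sum_nonneg_eq_0_iff del: mult_eq_0_iff)
    have "x i = y i" if "i \<in> {1..N}" for i
      using 0 pos[OF that] that by (metis abs_eq_0 eq_iff_diff_eq_0 less_irrefl mult_eq_0_iff power_eq_0_iff)
    then have "x i = y i" if "i \<in> {0..Suc N}" for i
      using that x y by (cases "i = 0 \<or> i = Suc N") (auto simp: ordered_simplex_def unit_partition_def)
    then show "x = y"
      using x y by (intro PiE_ext[of x "{0..Suc N}" _ y]) (auto simp: ordered_simplex_def)
  qed (simp add: partition_dist_def)
  have eq: "partition_dist N t u v = L2_set (\<lambda>i. (u i - v i) * sqrt (t (Suc i) - t i)) {1..N}" for u v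
    using pos unfolding partition_dist_def L2_set_def
    by (intro arg_cong[where f = sqrt] sum.cong) (auto simp: power_mult_distrib less_imp_le)
  show "partition_dist N t x z \<le> partition_dist N t x y + partition_dist N t y z"
    unfolding eq
    using L2_set_triangle_ineq[of "\<lambda>i. (x i - y i) * sqrt (t (Suc i) - t i)"
        "\<lambda>i. (y i - z i) * sqrt (t (Suc i) - t i)" "{1..N}"]
    by (simp add: algebra_simps)
qed

lemma integral_L2_triangle:
  fixes f g :: "'a \<Rightarrow> real"
  assumes f: "integrable M (\<lambda>x. (f x)\<^sup>2)" and g: "integrable M (\<lambda>x. (g x)\<^sup>2)"
    and fg: "integrable M (\<lambda>x. f x * g x)"
  shows "sqrt (LINT x|M. (f x + g x)\<^sup>2) \<le> sqrt (LINT x|M. (f x)\<^sup>2) + sqrt (LINT x|M. (g x)\<^sup>2)"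
proof -
  define A B C where "A = (LINT x|M. (f x)\<^sup>2)" "B = (LINT x|M. (g x)\<^sup>2)" "C = (LINT x|M. f x * g x)"
  note ABC = A_B_C_def
  have q: "(LINT x|M. (f x + s * g x)\<^sup>2) = A + 2 * s * C + s\<^sup>2 * B" for s
  proof -
    have "(LINT x|M. (f x + s * g x)\<^sup>2) = (LINT x|M. (f x)\<^sup>2 + 2 * s * (f x * g x) + s\<^sup>2 * (g x)\<^sup>2)"
      by (intro Bochner_Integration.integral_cong) (auto simp: power2_eq_square algebra_simps)
    also have "\<dots> = A + 2 * s * C + s\<^sup>2 * B"
      using f g fg by (simp add: ABC)
    finally show ?thesis .
  qed
  have nn: "A + 2 * s * C + s\<^sup>2 * B \<ge> 0" for s
    unfolding q[symmetric] by (intro Bochner_Integration.integral_nonneg) auto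
  have A: "A \<ge> 0" and B: "B \<ge> 0"
    by (auto simp: ABC)
  have "C\<^sup>2 \<le> A * B"
  proof (cases "B = 0")
    case True
    have "C = 0"
    proof (rule ccontr)
      assume "C \<noteq> 0"
      then show False using nn[of "- (A + 1) / (2 * C)"] True by (simp add: field_simps)
    qed
    then show ?thesis using True by simp
  next
    case False
    then have "B > 0" using B by simp
    then show ?thesis using nn[of "- C / B"] by (simp add: field_simps power2_eq_square)
  qed
  then have "\<bar>C\<bar> \<le> sqrt A * sqrt B"
    by (metis real_sqrt_abs real_sqrt_le_iff real_sqrt_mult)
  then have "A + 2 * C + B \<le> (sqrt A + sqrt B)\<^sup>2"
    using A B by (simp add: power2_sum)
  then have "sqrt (A + 2 * C + B) \<le> sqrt A + sqrt B"
    using A B by (intro real_le_lsqrt) auto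
  then show ?thesis
    using q[of 1] by (simp add: ABC)
qed

lemma G0_indicator:
  assumes "f \<in> G0_set"
  shows "(\<lambda>x. indicator {0..1} x * f x) \<in> borel_measurable lborel"
    and "\<bar>indicator {0..1} x * f x\<bar> \<le> 1"
proof -
  have "f \<in> borel_measurable (restrict_space borel {0..1})"
    using assms by (intro borel_measurable_mono_on_fnc) (auto simp: G0_set_def)
  then show "(\<lambda>x. indicator {0..1} x * f x) \<in> borel_measurable lborel"
    by (simp add: borel_measurable_restrict_space_iff mult.commute)
  show "\<bar>indicator {0..1} x * f x\<bar> \<le> 1"
    using assms by (auto simp: G0_set_def indicator_def PiE_iff)
qed

lemma G0_integrable:
  assumes "f \<in> G0_set" "g \<in> G0_set" "h \<in> G0_set" "k \<in> G0_set"
  shows "integrable lborel (\<lambda>x::real. (indicator {0..1} x * (f x - g x)) * (indicator {0..1} x * (h x - k x)))"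
proof (rule Bochner_Integration.integrable_bound)
  show "integrable lborel (\<lambda>x::real. 4 * indicator {0..1} x :: real)"
    by simp
  show "(\<lambda>x::real. (indicator {0..1} x * (f x - g x)) * (indicator {0..1} x * (h x - k x))) \<in> borel_measurable lborel"
    using assms[THEN G0_indicator(1)] unfolding right_diff_distrib by measurable
  have "\<bar>(f x - g x) * (h x - k x)\<bar> \<le> 4" if "x \<in> {0..1}" for x
  proof -
    have "\<bar>f x - g x\<bar> \<le> 2" "\<bar>h x - k x\<bar> \<le> 2"
      using G0_indicator(2)[OF assms(1), of x] G0_indicator(2)[OF assms(2), of x]
        G0_indicator(2)[OF assms(3), of x] G0_indicator(2)[OF assms(4), of x] that by auto
    then show ?thesis using mult_mono[of "\<bar>f x - g x\<bar>" 2 "\<bar>h x - k x\<bar>" 2] by (simp add: abs_mult)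
  qed
  then show "AE x in lborel. norm ((indicator {0..1} x * (f x - g x)) * (indicator {0..1} x * (h x - k x)))
      \<le> norm (4 * indicator {0..1} x :: real)"
    by (auto simp: indicator_def)
qed

lemma L2_dist_eq: "L2_dist f g = sqrt (LINT x|lborel. (indicator {0..1} x * (f x - g x))\<^sup>2)"
  unfolding L2_dist_def set_lebesgue_integral_def
  by (intro arg_cong[where f = sqrt] Bochner_Integration.integral_cong) (auto simp: indicator_def)

lemma G0_eqI:
  assumes f: "f \<in> G0_set" and g: "g \<in> G0_set" and 0: "L2_dist f g = 0"
  shows "f = g"
proof -
  have ae: "AE x in lborel. (indicator {0..1} x * (f x - g x))\<^sup>2 = 0"
    using 0 integral_nonneg_eq_0_iff_AE[OF G0_integrable[OF f g f g]]
    by (simp add: L2_dist_eq power2_eq_square)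
  have "f x = g x" if x: "x \<in> {0..<1}" for x
  proof (rule ccontr)
    assume ne: "f x \<noteq> g x"
    have "((\<lambda>y. f y - g y) \<longlongrightarrow> f x - g x) (at_right x)"
      using f g x by (intro tendsto_diff) (auto simp: G0_set_def continuous_within)
    then have "\<forall>\<^sub>F y in at_right x. f y - g y \<noteq> 0"
      using ne by (intro tendsto_imp_eventually_ne) auto
    then obtain b where b: "b > x" "\<And>y. x < y \<Longrightarrow> y < b \<Longrightarrow> f y \<noteq> g y"
      using eventually_at_right[of x "x + 1"] by auto
    define c where "c = min b 1"
    have c: "x < c" using b x by (simp add: c_def)
    have "AE y in lborel. y \<notin> {x<..<c}"
      using ae by eventually_elim (use b x in \<open>auto simp: c_def indicator_def split: if_splits\<close>)
    then have "emeasure lborel {x<..<c} = 0"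
      by (subst (asm) AE_iff_measurable[of "{x<..<c}"]) auto
    then show False using c by simp
  qed
  moreover have "f 1 = g 1" using f g by (simp add: G0_set_def)
  ultimately have "f x = g x" if "x \<in> {0..1}" for x
    using that by (cases "x = 1") auto
  then show ?thesis
    using f g by (intro PiE_ext[of f "{0..1}" _ g]) (auto simp: G0_set_def)
qed

lemma Metric_space_G0: "Metric_space G0_set L2_dist"
proof
  fix f g h
  show "0 \<le> L2_dist f g"
    unfolding L2_dist_eq by (simp add: Bochner_Integration.integral_nonneg)
  show "L2_dist f g = L2_dist g f"
    by (simp add: L2_dist_def power2_commute)
  assume fg: "f \<in> G0_set" "g \<in> G0_set"
  show "L2_dist f g = 0 \<longleftrightarrow> f = g"
    using G0_eqI[OF fg] by (auto simp: L2_dist_def set_lebesgue_integral_def)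
  assume h: "h \<in> G0_set"
  show "L2_dist f h \<le> L2_dist f g + L2_dist g h"
    using integral_L2_triangle[of lborel "\<lambda>x. indicator {0..1} x * (f x - g x)" "\<lambda>x. indicator {0..1} x * (g x - h x)"]
      G0_integrable[OF fg fg] G0_integrable[OF fg(2) h fg(2) h] G0_integrable[OF fg fg(2) h]
    by (simp add: L2_dist_eq power2_eq_square[symmetric] distrib_left[symmetric])
qed

lemma partition_space_simps:
  assumes "unit_partition N t"
  shows "mspace (partition_space N t) = ordered_simplex N"
    and "mdist (partition_space N t) = partition_dist N t"
proof -
  interpret Metric_space "ordered_simplex N" "partition_dist N t"
    by (rule Metric_space_partition[OF assms])
  show "mspace (partition_space N t) = ordered_simplex N"
    and "mdist (partition_space N t) = partition_dist N t"
    by (simp_all add: partition_space_def)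
qed

lemma G0_space_simps: "mspace G0_space = G0_set" "mdist G0_space = L2_dist"
proof -
  interpret Metric_space G0_set L2_dist
    by (rule Metric_space_G0)
  show "mspace G0_space = G0_set" "mdist G0_space = L2_dist"
    by (simp_all add: G0_space_def)
qed

end

theory Submission
  imports Defs
begin

text \<open>A point \<open>x\<close> of \<open>X({t\<^sub>i})\<close> is sent to the step function with value \<open>x\<^sub>i\<close> on \<open>[t\<^sub>i, t\<^sub>i\<^sub>+\<^sub>1)\<close>.  This map
  is exactly isometric, because \<open>x\<^sub>0 = 0\<close> for every point.  Its image is almost dense, uniformly:
  given \<open>g\<close>, the points \<open>x\<^sub>i = (1 - \<delta>) g(t\<^sub>i) + \<delta> t\<^sub>i\<close> for \<open>i > 0\<close> are strictly increasing, and since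
  the difference of the two functions is at most 1, its \<open>L\<^sup>2\<close> norm squared is at most its \<open>L\<^sup>1\<close> norm.
  This is at most \<open>3 \<delta>\<close>: \<open>\<delta>\<close> for the perturbation, \<open>\<delta>\<close> for the first interval, where
  \<open>x\<^sub>0 = 0\<close> is forced, and \<open>\<delta>\<close> for the telescoping sum of \<open>g(t\<^sub>i\<^sub>+\<^sub>1) - g(t\<^sub>i)\<close>.\<close>

section \<open>Partitions and the cell containing a point\<close>

lemma unit_partition_less:
  assumes "unit_partition N t" "i < j" "j \<le> Suc N"
  shows "t i < t j"
  using assms(2,3)
proof (induction j)
  case (Suc j)
  then have "t j < t (Suc j)"
    using assms(1) by (simp add: unit_partition_def)
  with Suc show ?case
    by (cases "i = j") auto
qed simp

lemma unit_partition_le: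
  assumes "unit_partition N t" "i \<le> j" "j \<le> Suc N"
  shows "t i \<le> t j"
  using unit_partition_less[OF assms(1), of i j] assms(2,3) by (cases "i = j") auto

lemma unit_partition_bounds:
  assumes "unit_partition N t" "i \<le> Suc N"
  shows "t i \<in> {0..1}"
  using unit_partition_le[OF assms(1), of 0 i] unit_partition_le[OF assms(1), of i "Suc N"] assms
  by (auto simp: unit_partition_def)

text \<open>For 0 \<le> s < 1 this is the cell \<open>[t i, t (Suc i))\<close> containing s. At s =
  1 it is \<open>Suc N\<close>, one past the last cell. For s < 0 the set is empty and the value
  unspecified.\<close>

definition partition_index :: "nat \<Rightarrow> (nat \<Rightarrow> real) \<Rightarrow> real \<Rightarrow> nat" where
  "partition_index N t s = Max {i. i \<le> Suc N \<and> t i \<le> s}"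

lemma partition_index_bounds:
  assumes "unit_partition N t" "0 \<le> s"
  shows "partition_index N t s \<le> Suc N" "t (partition_index N t s) \<le> s"
proof -
  have "partition_index N t s \<in> {i. i \<le> Suc N \<and> t i \<le> s}"
    unfolding partition_index_def
    by (rule Max_in) (use assms in \<open>auto simp: unit_partition_def\<close>)
  then show "partition_index N t s \<le> Suc N" "t (partition_index N t s) \<le> s"
    by auto
qed

lemma partition_index_mono:
  assumes "unit_partition N t" "0 \<le> s" "s \<le> s'"
  shows "partition_index N t s \<le> partition_index N t s'"
  unfolding partition_index_def
  by (rule Max_mono) (use assms in \<open>auto simp: unit_partition_def\<close>)

lemma partition_index_eq:
  assumes "unit_partition N t" "i \<le> N" "t i \<le> s" "s < t (Suc i)"
  shows "partition_index N t s = i"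
  unfolding partition_index_def
proof (rule Max_eqI)
  fix j assume "j \<in> {i. i \<le> Suc N \<and> t i \<le> s}"
  then show "j \<le> i"
    using unit_partition_le[OF assms(1), of "Suc i" j] assms(4) by force
qed (use assms in auto)

lemma partition_index_1:
  assumes "unit_partition N t"
  shows "partition_index N t 1 = Suc N"
  unfolding partition_index_def
  by (rule Max_eqI) (use assms in \<open>auto simp: unit_partition_def\<close>)

lemma partition_index_upper:
  assumes "unit_partition N t" "s \<in> {0..<1}"
  shows "partition_index N t s \<le> N" "s < t (Suc (partition_index N t s))"
proof -
  let ?i = "partition_index N t s"
  have "?i \<noteq> Suc N"
    using partition_index_bounds(2)[OF assms(1), of s] assms by (auto simp: unit_partition_def)
  then show le: "?i \<le> N"
    using partition_index_bounds(1)[OF assms(1), of s] assms by auto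
  show "s < t (Suc ?i)"
  proof (rule ccontr)
    assume "\<not> s < t (Suc ?i)"
    \<comment> \<open>Otherwise \<open>Suc ?i\<close> would belong to the set whose maximum is
      \<open>?i\<close>.\<close>
    then have "Suc ?i \<le> ?i"
      unfolding partition_index_def[of N t s] using le
      by (intro Max_ge) (auto simp: partition_index_def)
    then show False by simp
  qed
qed

section \<open>Step functions as elements of \<open>G0_set\<close>\<close>

text \<open>Restricted to [0,1] because members of \<open>G0_set\<close> are extensional. The
  conventional value \<open>x (Suc N) = 1\<close> becomes the value at s = 1.\<close>

definition step_fun :: "nat \<Rightarrow> (nat \<Rightarrow> real) \<Rightarrow> (nat \<Rightarrow> real) \<Rightarrow> real \<Rightarrow> real" where
  "step_fun N t x = (\<lambda>s\<in>{0..1}. x (partition_index N t s))"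

lemma step_fun_eq:
  assumes "unit_partition N t" "i \<le> N" "t i \<le> s" "s < t (Suc i)"
  shows "step_fun N t x s = x i"
proof -
  have "s \<in> {0..1}"
    using unit_partition_bounds[OF assms(1), of i] unit_partition_bounds[OF assms(1), of "Suc i"]
      assms(2-4) by auto
  then show ?thesis
    using partition_index_eq[OF assms] by (simp add: step_fun_def)
qed

lemma step_fun_1:
  assumes "unit_partition N t"
  shows "step_fun N t x 1 = x (Suc N)"
  using partition_index_1[OF assms] by (simp add: step_fun_def)

text \<open>Monotone as the composition of two monotone maps, s to its index and the index to its
  value. Right continuous because cells are closed on the left and open on the right, so the
  function is constant just to the right of each s < 1.\<close>

lemma step_fun_in_G0:
  assumes t: "unit_partition N t" and x: "x \<in> ordered_simplex N"
  shows "step_fun N t x \<in> G0_set"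
proof -
  have px: "unit_partition N x"
    using x by (simp add: ordered_simplex_def)
  have "step_fun N t x \<in> {0..1} \<rightarrow>\<^sub>E {0..1}"
    unfolding step_fun_def
    using unit_partition_bounds[OF px] partition_index_bounds[OF t] by auto
  moreover have "mono_on {0..1} (step_fun N t x)"
    by (rule mono_onI)
      (auto simp: step_fun_def intro!: unit_partition_le[OF px] partition_index_mono[OF t]
        partition_index_bounds[OF t])
  moreover have "continuous (at_right s) (step_fun N t x)" if s: "s \<in> {0..<1}" for s
  proof -
    define i where "i = partition_index N t s"
    have i: "i \<le> N" "t i \<le> s" "s < t (Suc i)"
      using partition_index_upper[OF t s] partition_index_bounds[OF t] s by (auto simp: i_def)
    have "\<forall>\<^sub>F r in at_right s. step_fun N t x r = step_fun N t x s"
      unfolding eventually_at_right_field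
      using i by (intro exI[of _ "t (Suc i)"]) (auto simp: step_fun_eq[OF t i(1)])
    then show ?thesis
      unfolding continuous_within by (rule tendsto_eventually)
  qed
  moreover have "step_fun N t x 1 = 1"
    using step_fun_1[OF t] px by (simp add: unit_partition_def)
  ultimately show ?thesis
    by (simp add: G0_set_def)
qed

section \<open>Integration cell by cell\<close>

text \<open>The cells are disjoint: if s lay in cells i and j, \<open>partition_index N t s\<close>
  would equal both. Integrands can thus be written as combinations of indicators.\<close>

lemma sum_partition_indicator:
  assumes t: "unit_partition N t" and i: "i \<le> N" "t i \<le> s" "s < t (Suc i)"
  shows "(\<Sum>j\<le>N. c j * indicator {t j..<t (Suc j)} s) = (c i :: real)"
proof -
  have "s \<in> {t j..<t (Suc j)} \<longleftrightarrow> j = i" if "j \<le> N" for j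
    using partition_index_eq[OF t i] partition_index_eq[OF t that, of s] i by force
  then have "(\<Sum>j\<le>N. c j * indicator {t j..<t (Suc j)} s) = (\<Sum>j\<le>N. if j = i then c j else 0)"
    by (intro sum.cong) (simp_all add: indicator_def)
  also have "\<dots> = c i"
    using i by simp
  finally show ?thesis .
qed

lemma sum_partition_indicator_outside:
  assumes t: "unit_partition N t" and s: "s \<notin> {0..<1}"
  shows "(\<Sum>j\<le>N. c j * indicator {t j..<t (Suc j)} s) = (0 :: real)"
proof (intro sum.neutral ballI)
  fix j assume "j \<in> {..N}"
  then have "s \<notin> {t j..<t (Suc j)}"
    using unit_partition_bounds[OF t, of j] unit_partition_bounds[OF t, of "Suc j"] s by auto
  then show "c j * indicator {t j..<t (Suc j)} s = 0"
    by simp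
qed

text \<open>The case split for pointwise statements on the whole line. The point 1 is separate: it
  lies in [0,1] but in no half-open cell.\<close>

lemma partition_cases:
  assumes t: "unit_partition N t"
  obtains i where "i \<le> N" "t i \<le> s" "s < t (Suc i)" | "s = 1" | "s \<notin> {0..1}"
  using partition_index_upper[OF t, of s] partition_index_bounds[OF t, of s]
  by (cases "s \<in> {0..<1}"; cases "s = 1") auto

lemma integral_partition:
  fixes c :: "nat \<Rightarrow> real"
  assumes t: "unit_partition N t"
  shows "integrable lborel (\<lambda>s. \<Sum>i\<le>N. c i * indicator {t i..<t (Suc i)} s)" (is "integrable _ ?f")
    and "(LINT s|lborel. (\<Sum>i\<le>N. c i * indicator {t i..<t (Suc i)} s))
      = (\<Sum>i\<le>N. c i * (t (Suc i) - t i))"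
proof -
  have le: "t i \<le> t (Suc i)" if "i \<le> N" for i
    using unit_partition_le[OF t] that by simp
  have int: "integrable lborel (\<lambda>s. c i * indicator {t i..<t (Suc i)} s)" if "i \<le> N" for i
    using le[OF that] by (intro integrable_mult_right) (simp add: emeasure_lborel_Ico)
  then show "integrable lborel ?f"
    by (intro Bochner_Integration.integrable_sum) auto
  have "(LINT s|lborel. ?f s) = (\<Sum>i\<le>N. LINT s|lborel. c i * indicator {t i..<t (Suc i)} s)"
    using int by (intro Bochner_Integration.integral_sum) auto
  also have "\<dots> = (\<Sum>i\<le>N. c i * (t (Suc i) - t i))"
    using le by (intro sum.cong) (auto simp: measure_def emeasure_lborel_Ico)
  finally show "(LINT s|lborel. ?f s) = (\<Sum>i\<le>N. c i * (t (Suc i) - t i))" .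
qed

section \<open>Isometry and uniform density\<close>

lemma L2_dist_step_fun:
  assumes t: "unit_partition N t" and x: "x \<in> ordered_simplex N" and y: "y \<in> ordered_simplex N"
  shows "L2_dist (step_fun N t x) (step_fun N t y) = partition_dist N t x y"
proof -
  have px: "x 0 = 0" "x (Suc N) = 1" and py: "y 0 = 0" "y (Suc N) = 1"
    using x y by (auto simp: ordered_simplex_def unit_partition_def)
  have "(indicator {0..1} s * (step_fun N t x s - step_fun N t y s))\<^sup>2
      = (\<Sum>i\<le>N. (x i - y i)\<^sup>2 * indicator {t i..<t (Suc i)} s)" for s
  proof (cases s rule: partition_cases[OF t])
    case (1 i)
    have "s \<in> {0..1}"
      using 1 unit_partition_bounds[OF t, of i] unit_partition_bounds[OF t, of "Suc i"] by auto
    then show ?thesis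
      using sum_partition_indicator[OF t 1] step_fun_eq[OF t 1] by simp
  next
    case 2
    then show ?thesis
      using sum_partition_indicator_outside[OF t, of s] step_fun_1[OF t] px py by simp
  next
    case 3
    then show ?thesis
      by (subst sum_partition_indicator_outside[OF t]) auto
  qed
  then have "L2_dist (step_fun N t x) (step_fun N t y)
      = sqrt (\<Sum>i\<le>N. (x i - y i)\<^sup>2 * (t (Suc i) - t i))"
    by (simp only: L2_dist_eq integral_partition(2)[OF t])
  \<comment> \<open>The term i = 0 vanishes since \<open>x 0 = y 0 = 0\<close>.\<close>
  also have "(\<Sum>i\<le>N. (x i - y i)\<^sup>2 * (t (Suc i) - t i))
      = (\<Sum>i=1..N. (x i - y i)\<^sup>2 * (t (Suc i) - t i))"
    using px py by (intro sum.mono_neutral_right) (auto simp: not_le)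
  also have "\<dots> = (\<Sum>i=1..N. \<bar>x i - y i\<bar>\<^sup>2 * \<bar>t (Suc i) - t i\<bar>)"
    using unit_partition_le[OF t] by (intro sum.cong) auto
  finally show ?thesis
    by (simp add: partition_dist_def)
qed

lemma step_fun_approx:
  assumes t: "unit_partition N t" and g: "g \<in> G0_set"
    and \<delta>: "0 < \<delta>" "\<delta> \<le> 1" "\<And>i. i \<le> N \<Longrightarrow> t (Suc i) - t i \<le> \<delta>"
  obtains x where "x \<in> ordered_simplex N" "L2_dist g (step_fun N t x) \<le> sqrt (3 * \<delta>)"
proof
  \<comment> \<open>Mixing with the strictly increasing t makes x strict even where g is constant.
    The value 0 at i = 0 is imposed, as g(0) may be positive; at \<open>Suc N\<close> the formula
    gives 1.\<close>
  define x where "x = (\<lambda>i\<in>{0..Suc N}. if i = 0 then 0 else (1 - \<delta>) * g (t i) + \<delta> * t i)"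
  note tb = unit_partition_bounds[OF t]
  have g01: "g s \<in> {0..1}" if "s \<in> {0..1}" for s
    using g that by (auto simp: G0_set_def)
  have gmono: "g r \<le> g s" if "r \<in> {0..1}" "s \<in> {0..1}" "r \<le> s" for r s
    using g that by (auto simp: G0_set_def mono_on_def)
  have g1: "g 1 = 1"
    using g by (simp add: G0_set_def)
  have t01: "t 0 = 0" "t (Suc N) = 1"
    using t by (auto simp: unit_partition_def)
  have "x i < x (Suc i)" if "i \<le> N" for i
  proof -
    have "(1 - \<delta>) * g (t i) \<le> (1 - \<delta>) * g (t (Suc i))"
      using tb that unit_partition_le[OF t, of i "Suc i"] \<delta>
      by (intro mult_left_mono gmono) auto
    moreover have "\<delta> * t i < \<delta> * t (Suc i)"
      using \<delta> unit_partition_less[OF t, of i "Suc i"] that by simp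
    \<comment> \<open>This serves the case i = 0, where the left value is 0 instead of the
      mixture.\<close>
    moreover have "0 \<le> (1 - \<delta>) * g (t i)"
      using \<delta> g01[OF tb[of i]] that by simp
    ultimately show ?thesis
      using that t01 by (auto simp: x_def)
  qed
  then have px: "unit_partition N x"
    using t01 g1 by (auto simp: unit_partition_def x_def)
  then show xs: "x \<in> ordered_simplex N"
    using unit_partition_bounds[OF px] by (auto simp: ordered_simplex_def x_def)
  \<comment> \<open>A bound for |g - x i| on cell i: the perturbation, the oscillation of g on the
    cell, and on the first cell the trivial bound 1.\<close>
  define c where "c = (\<lambda>i. \<delta> + (g (t (Suc i)) - g (t i)) + (if i = 0 then 1 else 0))"
  have bound: "(indicator {0..1} s * (g s - step_fun N t x s))\<^sup>2
      \<le> (\<Sum>i\<le>N. c i * indicator {t i..<t (Suc i)} s)" for s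
  proof (cases s rule: partition_cases[OF t])
    case (1 i)
    have ti: "t i \<in> {0..1}" "t (Suc i) \<in> {0..1}"
      using 1 tb by auto
    then have s: "s \<in> {0..1}"
      using 1 by auto
    have gs: "g (t i) \<le> g s" "g s \<le> g (t (Suc i))"
      using 1 ti s by (auto intro!: gmono)
    have "x i \<in> {0..1}"
      using unit_partition_bounds[OF px] 1 by simp
    then have le1: "\<bar>g s - x i\<bar> \<le> 1"
      using g01[OF s] by auto
    have "\<bar>g s - x i\<bar> \<le> c i"
    proof (cases "i = 0")
      case True
      then show ?thesis
        using le1 gs \<delta> by (auto simp: c_def)
    next
      case False
      have "x i = g (t i) + \<delta> * (t i - g (t i))"
        using False 1 by (simp add: x_def algebra_simps)
      moreover have "\<bar>\<delta> * (t i - g (t i))\<bar> \<le> \<delta> * 1"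
        unfolding abs_mult using \<delta> g01[OF ti(1)] ti by (intro mult_mono) auto
      ultimately show ?thesis
        using gs False by (auto simp: c_def)
    qed
    moreover have "(g s - x i)\<^sup>2 \<le> \<bar>g s - x i\<bar>"
      using mult_left_le[OF le1, of "\<bar>g s - x i\<bar>"] by (simp add: power2_eq_square)
    ultimately have "(g s - x i)\<^sup>2 \<le> c i"
      by linarith
    then show ?thesis
      using sum_partition_indicator[OF t 1, of c] step_fun_eq[OF t 1] s by simp
  next
    case 2
    then show ?thesis
      using sum_partition_indicator_outside[OF t, of s] step_fun_1[OF t] px g1
      by (simp add: unit_partition_def)
  next
    case 3
    then show ?thesis
      by (subst sum_partition_indicator_outside[OF t]) auto
  qed
  have gx: "step_fun N t x \<in> G0_set"
    by (rule step_fun_in_G0[OF t xs])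
  have "(LINT s|lborel. (indicator {0..1} s * (g s - step_fun N t x s))\<^sup>2)
      \<le> (LINT s|lborel. (\<Sum>i\<le>N. c i * indicator {t i..<t (Suc i)} s))"
    by (rule integral_mono[OF _ integral_partition(1)[OF t] bound])
      (simp only: power2_eq_square G0_integrable[OF g gx g gx])
  also have "\<dots> = (\<Sum>i\<le>N. c i * (t (Suc i) - t i))"
    by (rule integral_partition(2)[OF t])
  \<comment> \<open>The mesh bound replaces the cell length in the last two terms of
    \<open>c\<close> but not in the first, so that the cell lengths and the increments of g each
    telescope.\<close>
  also have "\<dots> \<le> (\<Sum>i\<le>N. \<delta> * (t (Suc i) - t i) + \<delta> * (g (t (Suc i)) - g (t i))
      + (if i = 0 then \<delta> else 0))"
  proof (rule sum_mono)
    fix i assume i: "i \<in> {..N}"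
    have "(g (t (Suc i)) - g (t i)) * (t (Suc i) - t i) \<le> (g (t (Suc i)) - g (t i)) * \<delta>"
      using \<delta>(3)[of i] i gmono[of "t i" "t (Suc i)"] tb unit_partition_le[OF t, of i "Suc i"]
      by (intro mult_left_mono) auto
    then show "c i * (t (Suc i) - t i)
      \<le> \<delta> * (t (Suc i) - t i) + \<delta> * (g (t (Suc i)) - g (t i)) + (if i = 0 then \<delta> else 0)"
      using \<delta>(3)[of i] i by (auto simp: c_def algebra_simps)
  qed
  also have "\<dots> = \<delta> * (\<Sum>i\<le>N. t (Suc i) - t i) + \<delta> * (\<Sum>i\<le>N. g (t (Suc i)) - g (t i)) + \<delta>"
    by (simp add: sum.distrib sum_distrib_left)
  also have "\<dots> = \<delta> * (t (Suc N) - t 0) + \<delta> * (g (t (Suc N)) - g (t 0)) + \<delta>"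
    using sum_lessThan_telescope[of t "Suc N"] sum_lessThan_telescope[of "\<lambda>i. g (t i)" "Suc N"]
    by (simp only: lessThan_Suc_atMost)
  \<comment> \<open>Both telescoped sums are at most 1, the second because g(0) \<ge> 0.\<close>
  also have "\<dots> \<le> 3 * \<delta>"
    using \<delta> g01[of 0] g1 by (simp add: t01 algebra_simps)
  finally show "L2_dist g (step_fun N t x) \<le> sqrt (3 * \<delta>)"
    by (simp add: L2_dist_eq)
qed

section \<open>Convergence\<close>

theorem proposition7p6:
  fixes N :: "nat \<Rightarrow> nat" and t :: "nat \<Rightarrow> nat \<Rightarrow> real"
  assumes "\<And>k. unit_partition (N k) (t k)"
    and "(\<lambda>k. SUP i\<in>{0..N k}. t k (Suc i) - t k i) \<longlonglongrightarrow> 0"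
  shows "GH_converges (\<lambda>k. partition_space (N k) (t k)) G0_space"
proof -
  define \<delta> where "\<delta> k = (SUP i\<in>{0..N k}. t k (Suc i) - t k i)" for k
  note t = assms(1)
  have gap: "t k (Suc i) - t k i \<le> \<delta> k" if "i \<le> N k" for k i
    unfolding \<delta>_def using that by (intro cSUP_upper) auto
  \<comment> \<open>An \<epsilon>-isometry requires \<epsilon> > 0.\<close>
  have pos: "0 < \<delta> k" for k
    using gap[of 0 k] unit_partition_less[OF t, of 0 "Suc 0" k] by simp
  \<comment> \<open>Needed for the weight 1 - \<delta> in the approximating points to be
    nonnegative.\<close>
  have le1: "\<delta> k \<le> 1" for k
    unfolding \<delta>_def
  proof (rule cSUP_least)
    fix i assume "i \<in> {0..N k}"
    then show "t k (Suc i) - t k i \<le> 1"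
      using unit_partition_bounds[OF t, of i k] unit_partition_bounds[OF t, of "Suc i" k] by auto
  qed simp
  have "(\<lambda>k. sqrt (3 * \<delta> k)) \<longlonglongrightarrow> sqrt (3 * 0)"
    using assms(2) unfolding \<delta>_def by (intro tendsto_intros)
  moreover have "eps_isometry (sqrt (3 * \<delta> k)) (partition_space (N k) (t k)) G0_space
      (step_fun (N k) (t k))" for k
    unfolding eps_isometry_def partition_space_simps[OF t] G0_space_simps
  proof (intro conjI ballI)
    fix g assume "g \<in> G0_set"
    then show "\<exists>x\<in>ordered_simplex (N k). L2_dist g (step_fun (N k) (t k) x) \<le> sqrt (3 * \<delta> k)"
      using step_fun_approx[OF t _ pos le1 gap] by metis
  qed (use pos[of k] step_fun_in_G0[OF t] L2_dist_step_fun[OF t] in \<open>auto simp: less_imp_le\<close>)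
  ultimately show ?thesis
    unfolding GH_converges_def
    by (intro exI[of _ "\<lambda>k. sqrt (3 * \<delta> k)"] exI[of _ "\<lambda>k. step_fun (N k) (t k)"]) simp
qed

end
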